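(* For every integer $n\geq 3$, $fsmp(BP_n)=fmp(BP_n)=n$.
   Context: A signed permutation of $\{1,\dots,n\}$ is a sequence $a_1\ldots a_n$ of elements of $\{\pm1,\dots,\pm n\}$ such that $|a_1|\ldots|a_n|$ is a permutation of $\{1,\dots,n\}$; write $\overline{a}=-a$. The burnt pancake graph $BP_n$ has all signed permutations of $\{1,\dots,n\}$ as vertices; $a_1\ldots a_n$ and $b_1\ldots b_n$ are adjacent iff for some $1\leq k\leq n$, $b_i=\overline{a_{k+1-i}}$ for $1\leq i\leq k$ and $b_i=a_i$ for $k+1\leq i\leq n$. A fractional perfect matching of $G$ is $g:E(G)\to[0,1]$ with $\sum_{e\ni v}g(e)=1$ for all $v$. $fmp(G)$ (resp. $fsmp(G)$) is the minimum size of a set $F\subseteq E(G)$ (resp. $F\subseteq V(G)\cup E(G)$) whose deletion (vertices with incident edges, and edges) leaves a graph with no fractional perfect matching. *)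

theory Defs
  imports Complex_Main "HOL-Library.Extended_Nat"
begin

text \<open>An undirected simple graph is a vertex set together with a set of edges, each edge being
  the set of its two endpoints.\<close>

type_synonym 'a graph = "'a set \<times> 'a set set"

definition verts :: "'a graph \<Rightarrow> 'a set" where
  "verts G = fst G"

definition edges :: "'a graph \<Rightarrow> 'a set set" where
  "edges G = snd G"

definition simple_graph :: "'a graph \<Rightarrow> bool" where
  "simple_graph G \<longleftrightarrow> (\<forall>e\<in>edges G. e \<subseteq> verts G \<and> card e = 2)"

text \<open>The values of \<open>g\<close> outside the edge set are irrelevant. The sum is meaningful for
  locally finite graphs; only finite graphs are used below. The empty graph has a (vacuous)
  fractional perfect matching.\<close>

definition fractional_perfect_matching :: "'a graph \<Rightarrow> ('a set \<Rightarrow> real) \<Rightarrow> bool" where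
  "fractional_perfect_matching G g \<longleftrightarrow>
     (\<forall>e\<in>edges G. 0 \<le> g e \<and> g e \<le> 1) \<and>
     (\<forall>v\<in>verts G. (\<Sum>e\<in>{e \<in> edges G. v \<in> e}. g e) = 1)"

definition delete_edges :: "'a graph \<Rightarrow> 'a set set \<Rightarrow> 'a graph" where
  "delete_edges G F = (verts G, edges G - F)"

text \<open>A subset of \<open>V(G) \<union> E(G)\<close> is a subset of the disjoint sum: \<open>Inl v\<close> is a vertex,
  \<open>Inr e\<close> an edge.\<close>

definition delete_verts_edges :: "'a graph \<Rightarrow> ('a + 'a set) set \<Rightarrow> 'a graph" where
  "delete_verts_edges G F =
     ({v \<in> verts G. Inl v \<notin> F},
      {e \<in> edges G. Inr e \<notin> F \<and> (\<forall>v\<in>e. Inl v \<notin> F)})"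

text \<open>The two numbers are extended naturals, so that they are \<open>\<infinity>\<close> if no suitable set exists;
  a finite value is always attained.\<close>

definition fmp :: "'a graph \<Rightarrow> enat" where
  "fmp G = (INF F \<in> {F. F \<subseteq> edges G \<and> finite F \<and>
       \<not> (\<exists>g. fractional_perfect_matching (delete_edges G F) g)}. enat (card F))"

definition fsmp :: "'a graph \<Rightarrow> enat" where
  "fsmp G = (INF F \<in> {F. F \<subseteq> verts G <+> edges G \<and> finite F \<and>
       \<not> (\<exists>g. fractional_perfect_matching (delete_verts_edges G F) g)}. enat (card F))"

definition signed_permutations :: "nat \<Rightarrow> int list set" where
  "signed_permutations n =
     {a. length a = n \<and> distinct (map abs a) \<and> set (map abs a) = {1..int n}}"

text \<open>List positions count from 0, so entry \<open>a\<^sub>i\<close> of the sequence is \<open>a ! (i - 1)\<close>.\<close>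

definition burnt_pancake_adj :: "nat \<Rightarrow> int list \<Rightarrow> int list \<Rightarrow> bool" where
  "burnt_pancake_adj n a b \<longleftrightarrow>
     (\<exists>k. 1 \<le> k \<and> k \<le> n \<and>
        (\<forall>i. 1 \<le> i \<and> i \<le> k \<longrightarrow> b ! (i - 1) = - (a ! (k + 1 - i - 1))) \<and>
        (\<forall>i. k + 1 \<le> i \<and> i \<le> n \<longrightarrow> b ! (i - 1) = a ! (i - 1)))"

definition burnt_pancake_graph :: "nat \<Rightarrow> int list graph" where
  "burnt_pancake_graph n =
     (signed_permutations n,
      {{a, b} | a b. a \<in> signed_permutations n \<and> b \<in> signed_permutations n \<and>
                     burnt_pancake_adj n a b})"

lemma burnt_pancake_adj_irrefl:
  assumes a: "a \<in> signed_permutations n"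
  shows "\<not> burnt_pancake_adj n a a"
proof
  assume "burnt_pancake_adj n a a"
  then obtain k where k: "1 \<le> k" "k \<le> n"
    and flip: "\<forall>i. 1 \<le> i \<and> i \<le> k \<longrightarrow> a ! (i - 1) = - (a ! (k + 1 - i - 1))"
    unfolding burnt_pancake_adj_def by blast
  have len: "length a = n" and dist: "distinct (map abs a)"
    and st: "set (map abs a) = {1..int n}"
    using a by (auto simp: signed_permutations_def)
  have eq: "a ! 0 = - (a ! (k - 1))"
    using flip[rule_format, of 1] k by simp
  then have "map abs a ! 0 = map abs a ! (k - 1)"
    using k len by simp
  then have "k - 1 = 0"
    using nth_eq_iff_index_eq[OF dist, of 0 "k - 1"] k len by simp
  with eq have "a ! 0 = 0" by simp
  moreover have "\<bar>a ! 0\<bar> \<in> {1..int n}"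
    using st k len by (metis nth_mem length_map nth_map less_le_trans zero_less_one)
  ultimately show False by simp
qed

lemma simple_graph_burnt_pancake_graph: "simple_graph (burnt_pancake_graph n)"
  using burnt_pancake_adj_irrefl
  by (fastforce simp: simple_graph_def burnt_pancake_graph_def verts_def edges_def card_2_iff)

end

theory Submission
  imports Defs
begin

text \<open>The graph is \<open>n\<close>-regular and its edges split into \<open>n\<close> perfect matchings, one for each
  reversal length. Deleting the \<open>n\<close> edges at a vertex isolates it, so both numbers are at most
  \<open>n\<close>. Conversely let fewer than \<open>n\<close> vertices and edges be deleted. If no vertex is among them, some
  perfect matching survives. Otherwise induct on \<open>n\<close>, cutting the graph into \<open>2n\<close> copies of the
  graph on \<open>n - 1\<close> symbols according to the last entry. If each copy has at most \<open>n - 2\<close>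
  faults, the induction hypothesis applies copy by copy. If one copy has all \<open>n - 1\<close>, restore a
  deleted vertex \<open>z\<close>, take a fractional perfect matching of the copy, delete \<open>z\<close> again, and
  reroute the weight of each edge \<open>zy\<close> to the edge leaving the copy at \<open>y\<close>; outside, take the
  corresponding convex combination of fractional perfect matchings missing one vertex each. The
  base case \<open>n = 3\<close> is settled by explicit alternating walks.\<close>

section \<open>Prefix reversals\<close>

text \<open>Signed permutations of an arbitrary set of positive integers: fixing the last entry of an
  arrangement of \<open>S\<close> to \<open>c\<close> leaves an arrangement of \<open>S - {\<bar>c\<bar>}\<close>, with no relabelling.\<close>

definition arrangements :: "int set \<Rightarrow> int list set" where
  "arrangements S = {x. distinct (map abs x) \<and> set (map abs x) = S}"

definition flip :: "nat \<Rightarrow> int list \<Rightarrow> int list" where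
  "flip k x = map uminus (rev (take k x)) @ drop k x"

lemma length_arrangement: "x \<in> arrangements S \<Longrightarrow> length x = card S"
  unfolding arrangements_def using distinct_card by fastforce

lemma length_flip [simp]: "length (flip k x) = length x"
  by (simp add: flip_def)

lemma map_abs_flip: "map abs (flip k x) = rev (take k (map abs x)) @ drop k (map abs x)"
  by (simp add: flip_def take_map drop_map rev_map)

lemma flip_arrangement: 
  assumes "x \<in> arrangements S" shows "flip k x \<in> arrangements S"
proof -
  let ?y = "map abs x"
  have d: "distinct (take k ?y @ drop k ?y)" and s: "set (take k ?y @ drop k ?y) = S"
    using assms by (auto simp only: arrangements_def append_take_drop_id mem_Collect_eq)
  show ?thesis
    unfolding arrangements_def mem_Collect_eq map_abs_flip using d s
    by (simp only: distinct_append set_append set_rev distinct_rev)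
qed

lemma flip_flip: "k \<le> length x \<Longrightarrow> flip k (flip k x) = x"
  by (simp add: flip_def rev_map)

lemma flip_snoc: "k \<le> length x \<Longrightarrow> flip k (x @ [c]) = flip k x @ [c]"
  by (simp add: flip_def)

lemma flip_nth:
  assumes "k \<le> length x" "i < length x"
  shows "flip k x ! i = (if i < k then - (x ! (k - 1 - i)) else x ! i)"
  using assms by (auto simp: flip_def nth_append rev_nth)

lemma snoc_arrangement_iff:
  "x @ [c] \<in> arrangements S \<longleftrightarrow> \<bar>c\<bar> \<in> S \<and> x \<in> arrangements (S - {\<bar>c\<bar>})"
proof -
  have "insert a T = S \<and> a \<notin> T \<longleftrightarrow> a \<in> S \<and> T = S - {a}" for a and T :: "int set" by blast
  from this[of "\<bar>c\<bar>" "set (map abs x)"]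
  have "set (map abs (x @ [c])) = S \<and> \<bar>c\<bar> \<notin> set (map abs x) \<longleftrightarrow>
     \<bar>c\<bar> \<in> S \<and> set (map abs x) = S - {\<bar>c\<bar>}" by simp
  moreover have "distinct (map abs (x @ [c])) \<longleftrightarrow> distinct (map abs x) \<and> \<bar>c\<bar> \<notin> set (map abs x)"
    by simp
  ultimately show ?thesis unfolding arrangements_def mem_Collect_eq by blast
qed

text \<open>At position \<open>l - 1\<close> one reversal keeps the entry and the other puts
  \<open>- (x ! 0)\<close>. Distinct absolute values then force \<open>l = 1\<close> and
  \<open>x ! 0 = 0\<close>, against positivity.\<close>

lemma flip_neq_less:
  assumes x: "x \<in> arrangements S" and S: "S \<subseteq> {0<..}" and kl: "k < l" "l \<le> card S"
  shows "flip k x \<noteq> flip l x"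
proof
  assume eq: "flip k x = flip l x"
  have len: "length x = card S" using x by (rule length_arrangement)
  have "flip k x ! (l - 1) = x ! (l - 1)" "flip l x ! (l - 1) = - (x ! 0)"
    using kl len flip_nth[of k x "l - 1"] flip_nth[of l x "l - 1"] by auto
  with eq have e: "x ! (l - 1) = - (x ! 0)" by simp
  then have "map abs x ! (l - 1) = map abs x ! 0" using kl len by simp
  then have "l - 1 = 0"
    using x kl len nth_eq_iff_index_eq[of "map abs x" "l - 1" 0] by (simp add: arrangements_def)
  with e have "x ! 0 = 0" by simp
  moreover have "\<bar>x ! 0\<bar> \<in> S" using x kl len by (force simp: arrangements_def)
  ultimately show False using S by auto
qed

lemma flip_inject:
  assumes "x \<in> arrangements S" "S \<subseteq> {0<..}" "k \<le> card S" "l \<le> card S"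
  shows "flip k x = flip l x \<longleftrightarrow> k = l"
  using assms flip_neq_less by (metis linorder_neqE_nat)

lemma flip_neq:
  assumes "x \<in> arrangements S" "S \<subseteq> {0<..}" "1 \<le> k" "k \<le> card S"
  shows "flip k x \<noteq> x"
  \<comment> \<open>\<open>flip 0\<close> is the identity.\<close>
  using flip_inject[of x S k 0] assms by (simp add: flip_def)

lemma flip_eq_iff:
  assumes "x \<in> arrangements S" "y \<in> arrangements S" "k \<le> card S"
  shows "flip k y = x \<longleftrightarrow> y = flip k x"
  using assms by (metis flip_flip length_arrangement)

text \<open>An edge determines its label: \<open>y\<close> is \<open>x\<close> or
  \<open>flip k x\<close>, and, \<open>flip l\<close> being an involution,
  \<open>flip k x = flip l x\<close> either way. Hence matchings of different labels are
  disjoint.\<close>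

lemma flip_edge_label:
  assumes x: "x \<in> arrangements S" and y: "y \<in> arrangements S" and S: "S \<subseteq> {0<..}"
    and kl: "k \<le> card S" "l \<le> card S"
    and eq: "{x, flip k x} = {y, flip l y}"
  shows "k = l"
proof -
  have "flip k x = flip l x"
    using eq flip_eq_iff[OF x y kl(2)] by (auto simp: doubleton_eq_iff)
  then show ?thesis using flip_inject[OF x S kl] by simp
qed

text \<open>The full reversal puts \<open>- (x ! 0)\<close> last, whose absolute value differs from
  that of the old last entry. So edges of the largest label always join different copies.\<close>

lemma last_flip_neq:
  assumes x: "x \<in> arrangements S" and c: "2 \<le> card S"
  shows "last (flip (card S) x) \<noteq> last x"
proof
  assume eq: "last (flip (card S) x) = last x"
  have len: "length x = card S" using x by (rule length_arrangement)
  have ne: "x \<noteq> []" "flip (card S) x \<noteq> []" using len c by (auto simp flip: length_greater_0_conv)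
  have "- (x ! 0) = x ! (card S - 1)"
    using eq ne len c by (simp add: last_conv_nth flip_nth)
  then have "map abs x ! 0 = map abs x ! (card S - 1)" using len c by simp
  then have "0 = card S - 1"
    using x c len nth_eq_iff_index_eq[of "map abs x" 0 "card S - 1"] by (simp add: arrangements_def)
  with c show False by simp
qed

section \<open>Edge weightings with prescribed vertex sums\<close>

text \<open>\<open>h k x\<close> is the weight of the edge \<open>{x, flip k x}\<close>, \<open>d\<close> prescribes the vertex sums, and the
  edges in \<open>Z\<close> get weight 0. A deleted vertex is a vertex with \<open>d x = 0\<close>.\<close>

definition weighting :: "int set \<Rightarrow> (int list \<Rightarrow> real) \<Rightarrow> int list set set \<Rightarrow> (nat \<Rightarrow> int list \<Rightarrow> real) \<Rightarrow> bool" where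
  "weighting S d Z h \<longleftrightarrow>
     (\<forall>x\<in>arrangements S. \<forall>k\<in>{1..card S}.
        0 \<le> h k x \<and> h k (flip k x) = h k x \<and> ({x, flip k x} \<in> Z \<longrightarrow> h k x = 0)) \<and>
     (\<forall>x\<in>arrangements S. (\<Sum>k\<in>{1..card S}. h k x) = d x)"

definition feasible :: "int set \<Rightarrow> (int list \<Rightarrow> real) \<Rightarrow> int list set set \<Rightarrow> bool" where
  "feasible S d Z \<longleftrightarrow> (\<exists>h. weighting S d Z h)"

lemma weightingI:
  assumes "\<And>x k. x \<in> arrangements S \<Longrightarrow> k \<in> {1..card S} \<Longrightarrow> 0 \<le> h k x"
    and "\<And>x k. x \<in> arrangements S \<Longrightarrow> k \<in> {1..card S} \<Longrightarrow> h k (flip k x) = h k x"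
    and "\<And>x k. x \<in> arrangements S \<Longrightarrow> k \<in> {1..card S} \<Longrightarrow> {x, flip k x} \<in> Z \<Longrightarrow> h k x = 0"
    and "\<And>x. x \<in> arrangements S \<Longrightarrow> (\<Sum>k\<in>{1..card S}. h k x) = d x"
  shows "weighting S d Z h"
  unfolding weighting_def using assms by blast

lemma weightingD:
  assumes "weighting S d Z h" "x \<in> arrangements S"
  shows "k \<in> {1..card S} \<Longrightarrow> 0 \<le> h k x"
    and "k \<in> {1..card S} \<Longrightarrow> h k (flip k x) = h k x"
    and "k \<in> {1..card S} \<Longrightarrow> {x, flip k x} \<in> Z \<Longrightarrow> h k x = 0"
    and "(\<Sum>k\<in>{1..card S}. h k x) = d x"
  using assms unfolding weighting_def by blast+

lemma feasibleI: "weighting S d Z h \<Longrightarrow> feasible S d Z"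
  unfolding feasible_def by blast

lemma feasibleE:
  assumes "feasible S d Z" obtains h where "weighting S d Z h"
  using assms unfolding feasible_def by blast

lemma feasible_cong:
  assumes "feasible S d Z" "\<And>x. x \<in> arrangements S \<Longrightarrow> d x = d' x"
  shows "feasible S d' Z"
  using assms unfolding feasible_def weighting_def by simp

text \<open>For fixed \<open>Z\<close> the feasible vertex sums form a convex cone, which allows
  weightings to be added and averaged.\<close>

lemma feasible_zero: "feasible S (\<lambda>_. 0) Z"
  by (rule feasibleI[OF weightingI[where h = "\<lambda>_ _. 0"]]) simp_all

lemma feasible_add:
  assumes "feasible S d Z" "feasible S d' Z"
  shows "feasible S (\<lambda>x. d x + d' x) Z"
proof -
  obtain h h' where h: "weighting S d Z h" "weighting S d' Z h'"
    using assms feasibleE by metis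
  show ?thesis
  proof (rule feasibleI[OF weightingI[where h = "\<lambda>k x. h k x + h' k x"]], goal_cases)
    case (1 x k) then show ?case using h[THEN weightingD(1)] by (simp add: add_nonneg_nonneg)
  next
    case (2 x k) then show ?case using h[THEN weightingD(2)] by simp
  next
    case (3 x k) then show ?case using h[THEN weightingD(3)] by simp
  next
    case (4 x) then show ?case using h[THEN weightingD(4)] by (simp add: sum.distrib)
  qed
qed

lemma feasible_scale:
  assumes "feasible S d Z" "0 \<le> c"
  shows "feasible S (\<lambda>x. c * d x) Z"
proof -
  obtain h where h: "weighting S d Z h" using assms feasibleE by metis
  show ?thesis
  proof (rule feasibleI[OF weightingI[where h = "\<lambda>k x. c * h k x"]], goal_cases)
    case (1 x k) then show ?case using weightingD(1)[OF h] assms(2) by simp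
  next
    case (2 x k) then show ?case using weightingD(2)[OF h] by simp
  next
    case (3 x k) then show ?case using weightingD(3)[OF h] by simp
  next
    case (4 x) then show ?case using weightingD(4)[OF h] by (simp flip: sum_distrib_left)
  qed
qed

lemma feasible_sum:
  assumes "finite I" "\<And>i. i \<in> I \<Longrightarrow> feasible S (d i) Z"
  shows "feasible S (\<lambda>x. \<Sum>i\<in>I. d i x) Z"
  using assms by (induction I rule: finite_induct) (simp_all add: feasible_zero feasible_add)

text \<open>Weight 1 goes to the edges of label \<open>l\<close> outside \<open>P\<close>; since
  \<open>flip l\<close> is an involution, the complement of \<open>P\<close> is closed under it
  too.\<close>

lemma feasible_matching:
  assumes l: "l \<in> {1..card S}"
    and P: "\<And>x. x \<in> P \<Longrightarrow> x \<in> arrangements S \<Longrightarrow> flip l x \<in> P"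
    and Z: "\<And>x. x \<in> arrangements S \<Longrightarrow> x \<notin> P \<Longrightarrow> {x, flip l x} \<notin> Z"
  shows "feasible S (\<lambda>x. of_bool (x \<notin> P)) Z"
proof (rule feasibleI[OF weightingI[where h = "\<lambda>k x. of_bool (k = l \<and> x \<notin> P)"]])
  fix x k assume x: "x \<in> arrangements S" "k \<in> {1..card S}"
  have "flip l x \<in> P \<longleftrightarrow> x \<in> P"
    using P x l flip_arrangement flip_flip length_arrangement
    by (metis atLeastAtMost_iff)
  then show "of_bool (k = l \<and> flip k x \<notin> P) = (of_bool (k = l \<and> x \<notin> P) :: real)" by auto
next
  fix x assume "x \<in> arrangements S"
  have "(\<Sum>k=1..card S. of_bool (k = l \<and> x \<notin> P)) = (\<Sum>k=1..card S. if k = l then of_bool (x \<notin> P) else (0::real))"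
    by (rule sum.cong) auto
  then show "(\<Sum>k=1..card S. of_bool (k = l \<and> x \<notin> P)) = (of_bool (x \<notin> P) :: real)"
    using l by simp
qed (use Z in auto)

lemma feasible_edge:
  assumes y: "y \<in> arrangements S" and S: "S \<subseteq> {0<..}" and l: "l \<in> {1..card S}"
    and Z: "{y, flip l y} \<notin> Z"
  shows "feasible S (\<lambda>x. of_bool (x = y) + of_bool (x = flip l y)) Z"
proof -
  have n: "flip l y \<noteq> y" using flip_neq[OF y S] l by simp
  have ff: "flip l (flip l y) = y" using y l flip_flip length_arrangement by auto
  have "feasible S (\<lambda>x. of_bool (x \<notin> - {y, flip l y})) Z"
  proof (rule feasible_matching[OF l])
    fix x assume x: "x \<in> - {y, flip l y}" "x \<in> arrangements S"
    then have "flip l (flip l x) = x" using l flip_flip length_arrangement by auto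
    then show "flip l x \<in> - {y, flip l y}" using x ff by auto
  next
    fix x assume "x \<notin> - {y, flip l y}"
    then show "{x, flip l x} \<notin> Z" using Z ff by (auto simp: insert_commute)
  qed
  then show ?thesis by (rule feasible_cong) (use n in auto)
qed

text \<open>Every edge has one label, so fewer than \<open>card S\<close> faults miss some label,
  and its perfect matching survives whole.\<close>

lemma feasible_no_vertex_faults:
  assumes S: "S \<subseteq> {0<..}" and Z: "finite Z" "card Z < card S"
  shows "feasible S (\<lambda>x. 1) Z"
proof -
  have "\<exists>l\<in>{1..card S}. \<forall>x\<in>arrangements S. {x, flip l x} \<notin> Z"
  proof (rule ccontr)
    assume "\<not> ?thesis"
    then have "\<forall>l\<in>{1..card S}. \<exists>x. x \<in> arrangements S \<and> {x, flip l x} \<in> Z" by blast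
    then obtain f where f: "\<And>l. l \<in> {1..card S} \<Longrightarrow> f l \<in> arrangements S \<and> {f l, flip l (f l)} \<in> Z"
      by metis
    have "inj_on (\<lambda>l. {f l, flip l (f l)}) {1..card S}"
      by (rule inj_onI, rule flip_edge_label[OF _ _ S]) (use f in auto)
    then have "card {1..card S} \<le> card Z"
      by (rule card_inj_on_le) (use f Z in auto)
    with Z show False by simp
  qed
  then obtain l where l: "l \<in> {1..card S}" "\<And>x. x \<in> arrangements S \<Longrightarrow> {x, flip l x} \<notin> Z" by blast
  have "feasible S (\<lambda>x. of_bool (x \<notin> {})) Z"
    using l by (intro feasible_matching) auto
  then show ?thesis by simp
qed

text \<open>Labels below \<open>card S\<close> fix the last entry, so weightings of the copies
  combine; edges of label \<open>card S\<close>, which leave the copies, get weight 0.\<close>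

lemma feasible_glue:
  assumes S: "finite S" "S \<noteq> {}"
    and f: "\<And>c. \<bar>c\<bar> \<in> S \<Longrightarrow> feasible (S - {\<bar>c\<bar>}) (\<lambda>x. d (x @ [c])) {e. (\<lambda>x. x @ [c]) ` e \<in> Z}"
  shows "feasible S d Z"
proof -
  define n where "n = card S - 1"
  have n: "card S = Suc n" using S by (simp add: n_def card_gt_0_iff)
  have card: "card (S - {\<bar>c\<bar>}) = n" if "\<bar>c\<bar> \<in> S" for c using that S by (simp add: n_def)
  have "\<forall>c. \<exists>h. \<bar>c\<bar> \<in> S \<longrightarrow>
     weighting (S - {\<bar>c\<bar>}) (\<lambda>x. d (x @ [c])) {e. (\<lambda>x. x @ [c]) ` e \<in> Z} h"
    using f unfolding feasible_def by blast
  then obtain h where h: "\<And>c. \<bar>c\<bar> \<in> S \<Longrightarrow>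
     weighting (S - {\<bar>c\<bar>}) (\<lambda>x. d (x @ [c])) {e. (\<lambda>x. x @ [c]) ` e \<in> Z} (h c)"
    by metis
  define H where "H = (\<lambda>k x. if k \<le> n then h (last x) k (butlast x) else 0)"
  have split: "\<exists>y c. x = y @ [c] \<and> \<bar>c\<bar> \<in> S \<and> y \<in> arrangements (S - {\<bar>c\<bar>}) \<and> length y = n"
    if x: "x \<in> arrangements S" for x
  proof -
    have "x \<noteq> []" using length_arrangement[OF x] n by auto
    then obtain y c where yc: "x = y @ [c]" by (metis rev_exhaust)
    then show ?thesis using x snoc_arrangement_iff[of y c S] length_arrangement[OF x] n by auto
  qed
  show ?thesis
  proof (rule feasibleI[OF weightingI[where h = H]])
    fix x k assume x: "x \<in> arrangements S" "k \<in> {1..card S}"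
    obtain y c where y: "x = y @ [c]" "\<bar>c\<bar> \<in> S" "y \<in> arrangements (S - {\<bar>c\<bar>})" "length y = n"
      using split x(1) by metis
    note hD = weightingD(1-3)[OF h[OF y(2)] y(3), where k = k, unfolded card[OF y(2)]]
    show "0 \<le> H k x" using y hD x by (auto simp: H_def)
    show "H k (flip k x) = H k x" using y hD x by (auto simp: H_def flip_snoc)
    show "H k x = 0" if "{x, flip k x} \<in> Z"
      using that y hD x by (auto simp: H_def flip_snoc)
  next
    fix x assume x: "x \<in> arrangements S"
    obtain y c where y: "x = y @ [c]" "\<bar>c\<bar> \<in> S" "y \<in> arrangements (S - {\<bar>c\<bar>})" "length y = n"
      using split x(1) by metis
    show "(\<Sum>k\<in>{1..card S}. H k x) = d x"
      unfolding n using weightingD(4)[OF h[OF y(2)] y(3), unfolded card[OF y(2)]] y(1)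
      by (simp add: H_def)
  qed
qed

section \<open>Alternating walks\<close>

text \<open>From \<open>q\<close>, flips by the successive labels in \<open>js\<close> alternate with flips by \<open>l\<close>. With
  \<open>q = flip l v\<close>, the vertices of \<open>v # walk l js q\<close> form a path that is alternating for the
  perfect matching of label \<open>l\<close>; switching along it exposes exactly \<open>v\<close> and the last vertex.
  \<open>steps\<close> lists the path edges outside the matching, \<open>ends\<close> the possible final vertices.\<close>

fun walk :: "nat \<Rightarrow> nat list \<Rightarrow> int list \<Rightarrow> int list list" where
  "walk l [] q = [q]"
| "walk l (j # js) q = q # flip j q # walk l js (flip l (flip j q))"

fun steps :: "nat \<Rightarrow> nat list \<Rightarrow> int list \<Rightarrow> (nat \<times> int list) list" where
  "steps l [] q = []"
| "steps l (j # js) q = (j, q) # steps l js (flip l (flip j q))"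

fun ends :: "nat \<Rightarrow> nat list \<Rightarrow> int list \<Rightarrow> int list list" where
  "ends l [] q = [q]"
| "ends l (j # js) q = q # ends l js (flip l (flip j q))"

lemma walk_nonempty [simp]: "walk l js q \<noteq> []"
  by (cases js) auto

lemma walk_arrangements:
  "q \<in> arrangements S \<Longrightarrow> set (walk l js q) \<subseteq> arrangements S"
  by (induction l js q rule: walk.induct) (auto simp: flip_arrangement)

text \<open>With \<open>flip l q\<close> put in front, consecutive vertices of the walk pair up into
  edges of label \<open>l\<close>.\<close>

lemma walk_flip_closed:
  assumes "q \<in> arrangements S" "l \<le> card S"
    and "x = flip l q \<or> x \<in> set (walk l js q)"
  shows "flip l x = flip l q \<or> flip l x \<in> set (walk l js q)"
  using assms
proof (induction l js q arbitrary: x rule: walk.induct)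
  case (1 l q)
  then show ?case using flip_flip[of l q] length_arrangement[of q S] by auto
next
  case (2 l j js q)
  have q': "flip l (flip j q) \<in> arrangements S" using 2(2) by (simp add: flip_arrangement)
  have ff: "flip l (flip l q) = q" "flip l (flip l (flip j q)) = flip j q"
    using 2(2,3) flip_flip[of l] length_arrangement[of q S] by auto
  from 2(4) consider "x = flip l q" | "x = q" | "x = flip j q \<or> x \<in> set (walk l js (flip l (flip j q)))"
    by auto
  then show ?case
  proof cases
    case 3
    then show ?thesis using 2(1)[OF q' 2(3), of x] ff by auto
  qed (use ff in auto)
qed

text \<open>The edges in \<open>steps\<close> pair up all vertices of the walk but the last;
  distinctness makes them disjoint, so each can get weight 1.\<close>

lemma feasible_steps:
  assumes "q \<in> arrangements S" "S \<subseteq> {0<..}" "set js \<subseteq> {1..card S}" "distinct (walk l js q)"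
    and "\<forall>(j, y) \<in> set (steps l js q). {y, flip j y} \<notin> Z"
  shows "feasible S (\<lambda>x. of_bool (x \<in> set (butlast (walk l js q)))) Z"
  using assms
proof (induction l js q rule: walk.induct)
  case (1 l q)
  then show ?case by (simp add: feasible_zero)
next
  case (2 l j js q)
  let ?q = "flip l (flip j q)"
  have "feasible S (\<lambda>x. of_bool (x \<in> set (butlast (walk l js ?q)))) Z"
    by (rule 2(1)) (use 2(2-) in \<open>auto simp: flip_arrangement\<close>)
  moreover have "feasible S (\<lambda>x. of_bool (x = q) + of_bool (x = flip j q)) Z"
    by (rule feasible_edge) (use 2(2-) in auto)
  ultimately have "feasible S (\<lambda>x. of_bool (x \<in> set (butlast (walk l js ?q))) +
      (of_bool (x = q) + of_bool (x = flip j q))) Z"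
    by (rule feasible_add)
  then show ?case
    by (rule feasible_cong) (use 2(5) in \<open>auto dest: in_set_butlastD\<close>)
qed

text \<open>Switching along the path: the matching of label \<open>l\<close> is kept off the path,
  and the edges in \<open>steps\<close> are used on it.\<close>

lemma feasible_walk:
  assumes v: "v \<in> arrangements S" and S: "S \<subseteq> {0<..}" and l: "l \<in> {1..card S}"
    and js: "set js \<subseteq> {1..card S}" and d: "distinct (v # walk l js (flip l v))"
    and Zl: "\<And>x. x \<in> arrangements S \<Longrightarrow> {x, flip l x} \<notin> Z"
    and Z: "\<forall>(j, y) \<in> set (steps l js (flip l v)). {y, flip j y} \<notin> Z"
  shows "feasible S (\<lambda>x. of_bool (x \<noteq> v \<and> x \<noteq> last (walk l js (flip l v)))) Z"
proof -
  let ?w = "walk l js (flip l v)"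
  have q: "flip l v \<in> arrangements S" using v by (rule flip_arrangement)
  have ff: "flip l (flip l v) = v" using v l flip_flip length_arrangement by auto
  have closed: "flip l x \<in> set (v # ?w)" if "x \<in> set (v # ?w)" for x
    using walk_flip_closed[OF q, of l x js] that l ff by auto
  have "feasible S (\<lambda>x. of_bool (x \<notin> set (v # ?w))) Z"
    by (rule feasible_matching[OF l closed Zl])
  moreover have "feasible S (\<lambda>x. of_bool (x \<in> set (butlast ?w))) Z"
    by (rule feasible_steps[OF q S js _ Z]) (use d in auto)
  ultimately have *: "feasible S (\<lambda>x. of_bool (x \<notin> set (v # ?w)) + of_bool (x \<in> set (butlast ?w))) Z"
    by (rule feasible_add)
  obtain us u where "?w = us @ [u]" by (metis rev_exhaust walk_nonempty)
  then show ?thesis using d by (intro feasible_cong[OF *]) auto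
qed

text \<open>Each vertex in \<open>ends\<close> is reached by truncating \<open>js\<close>; one long
  walk without repetition thus provides many alternating paths.\<close>

lemma ends_walk_prefix:
  assumes "w \<in> set (ends l js q)"
  obtains ks r where "set ks \<subseteq> set js" "walk l js q = walk l ks q @ r" "last (walk l ks q) = w"
proof -
  have "\<exists>ks r. set ks \<subseteq> set js \<and> walk l js q = walk l ks q @ r \<and> last (walk l ks q) = w"
    using assms
  proof (induction l js q rule: ends.induct)
    case (1 l q)
    then show ?case by (intro exI[of _ "[]"]) auto
  next
    case (2 l j js q)
    show ?case
    proof (cases "w = q")
      case True
      then show ?thesis
        by (intro exI[of _ "[]"] exI[of _ "flip j q # walk l js (flip l (flip j q))"]) auto
    next
      case False
      then obtain ks r where "set ks \<subseteq> set js"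
        "walk l js (flip l (flip j q)) = walk l ks (flip l (flip j q)) @ r"
        "last (walk l ks (flip l (flip j q))) = w" using 2 by auto
      then show ?thesis by (intro exI[of _ "j # ks"] exI[of _ r]) auto
    qed
  qed
  then show ?thesis using that by blast
qed

lemma feasible_ends:
  assumes "v \<in> arrangements S" "S \<subseteq> {0<..}" "l \<in> {1..card S}"
    and js: "set js \<subseteq> {1..card S}" and d: "distinct (v # walk l js (flip l v))"
    and w: "w \<in> set (ends l js (flip l v))"
  shows "feasible S (\<lambda>x. of_bool (x \<noteq> v \<and> x \<noteq> w)) {}"
proof -
  obtain ks r where i: "set ks \<subseteq> set js" "walk l js (flip l v) = walk l ks (flip l v) @ r"
    "last (walk l ks (flip l v)) = w"
    using ends_walk_prefix[OF w] by metis
  have "feasible S (\<lambda>x. of_bool (x \<noteq> v \<and> x \<noteq> last (walk l ks (flip l v)))) {}"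
    by (rule feasible_walk) (use assms i in auto)
  with i show ?thesis by simp
qed

text \<open>Average a weighting missing \<open>v\<close> and \<open>w\<close> with one missing \<open>v\<close> and \<open>u\<close>, where \<open>u\<close> and \<open>w\<close> are
  adjacent, and give the edge \<open>{u, w}\<close> the weight 1/2.\<close>

lemma feasible_two_walks:
  assumes v: "v \<in> arrangements S" and S: "S \<subseteq> {0<..}"
    and l: "l \<in> {1..card S}" "set js \<subseteq> {1..card S}" "distinct (v # walk l js (flip l v))"
    and l': "l' \<in> {1..card S}" "set js' \<subseteq> {1..card S}" "distinct (v # walk l' js' (flip l' v))"
    and j: "j \<in> {1..card S}"
      "last (walk l' js' (flip l' v)) = flip j (last (walk l js (flip l v)))"
    and Zl: "\<And>x. x \<in> arrangements S \<Longrightarrow> {x, flip l x} \<notin> Z"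
      "\<And>x. x \<in> arrangements S \<Longrightarrow> {x, flip l' x} \<notin> Z"
    and Z: "\<forall>(i, y) \<in> set (steps l js (flip l v) @ steps l' js' (flip l' v) @
      [(j, last (walk l js (flip l v)))]). {y, flip i y} \<notin> Z"
  shows "feasible S (\<lambda>x. of_bool (x \<noteq> v)) Z"
proof -
  define w where "w = last (walk l js (flip l v))"
  have "w \<in> set (walk l js (flip l v))" "flip j w \<in> set (walk l' js' (flip l' v))"
    unfolding w_def j(2)[symmetric] by (simp_all only: last_in_set[OF walk_nonempty])
  moreover have "v \<notin> set (walk l js (flip l v))" "v \<notin> set (walk l' js' (flip l' v))"
    using l(3) l'(3) by simp_all
  ultimately have w: "w \<in> arrangements S" "w \<noteq> v" "flip j w \<noteq> v"
    using walk_arrangements[OF flip_arrangement[OF v], of l js l] by blast+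
  have "flip j w \<noteq> w" using flip_neq[OF w(1) S] j by simp
  have a: "feasible S (\<lambda>x. of_bool (x \<noteq> v \<and> x \<noteq> w)) Z"
    unfolding w_def by (rule feasible_walk[OF v S l Zl(1)]) (use Z in auto)
  have b: "feasible S (\<lambda>x. of_bool (x \<noteq> v \<and> x \<noteq> flip j w)) Z"
    unfolding w_def j(2)[symmetric] by (rule feasible_walk[OF v S l' Zl(2)]) (use Z in auto)
  have c: "feasible S (\<lambda>x. of_bool (x = w) + of_bool (x = flip j w)) Z"
    by (rule feasible_edge[OF w(1) S j(1)]) (use Z w_def in auto)
  show ?thesis
    by (rule feasible_cong[OF feasible_scale[OF feasible_add[OF a feasible_add[OF b c]], of "1 / 2"]])
      (use w \<open>flip j w \<noteq> w\<close> in auto)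
qed

section \<open>Two faults for three symbols\<close>

lemma flip3:
  "flip 1 [x, y, z] = [- x, y, z]" "flip (Suc 0) [x, y, z] = [- x, y, z]"
  "flip 2 [x, y, z] = [- y, - x, z]" "flip 3 [x, y, z] = [- z, - y, - x]"
  by (simp_all add: flip_def)

text \<open>Every inequation is listed in all orientations, so that the simplifier decides each
  equation between signed entries.\<close>

lemma arrangement3E:
  assumes v: "v \<in> arrangements S" and S: "S \<subseteq> {0<..}" "card S = 3"
  obtains a b c where "v = [a, b, c]" "S = {\<bar>a\<bar>, \<bar>b\<bar>, \<bar>c\<bar>}" "a \<noteq> 0" "b \<noteq> 0" "c \<noteq> 0"
    "a \<noteq> b" "a \<noteq> - b" "a \<noteq> c" "a \<noteq> - c" "b \<noteq> c" "b \<noteq> - c"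
    "b \<noteq> a" "- b \<noteq> a" "- a \<noteq> b" "b \<noteq> - a" "c \<noteq> a" "- c \<noteq> a" "- a \<noteq> c" "c \<noteq> - a"
    "c \<noteq> b" "- c \<noteq> b" "- b \<noteq> c" "c \<noteq> - b"
proof -
  have "length v = 3" using length_arrangement[OF v] S by simp
  then obtain a b c where v_eq: "v = [a, b, c]" by (auto simp: numeral_3_eq_3 length_Suc_conv)
  from v v_eq have "\<bar>a\<bar> \<noteq> \<bar>b\<bar>" "\<bar>a\<bar> \<noteq> \<bar>c\<bar>" "\<bar>b\<bar> \<noteq> \<bar>c\<bar>" and S_eq: "S = {\<bar>a\<bar>, \<bar>b\<bar>, \<bar>c\<bar>}"
    by (auto simp: arrangements_def)
  moreover from S_eq have "a \<noteq> 0" "b \<noteq> 0" "c \<noteq> 0" using S(1) by auto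
  ultimately show ?thesis
    by (intro that[of a b c] v_eq) simp_all
qed

lemma feasible_two_vertex_faults:
  assumes v: "v \<in> arrangements S" and w: "w \<in> arrangements S" "w \<noteq> v"
    and S: "S \<subseteq> {0<..}" "card S = 3"
  shows "feasible S (\<lambda>x. of_bool (x \<noteq> v \<and> x \<noteq> w)) {}"
proof -
  define A B C :: "nat list" where
    "A = [2, 3, 3, 2, 3, 2, 2, 3, 3, 3, 2, 3, 3, 3, 2, 3, 3, 3, 2, 2, 3, 2]"
    and "B = [3, 2, 3, 3, 3, 2, 3, 3, 3, 2, 3, 3, 3, 2, 2, 3, 2, 3, 3, 3, 2, 3, 3]"
    and "C = [2, 3, 2]"
  \<comment> \<open>Found by computer search: the first two walks are Hamiltonian or nearly so, and the
    final vertices of the three walks cover all vertices but \<open>v\<close>.\<close>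
  note ABC = A_def B_def C_def
  from v S obtain a b c where abc: "v = [a, b, c]" "S = {\<bar>a\<bar>, \<bar>b\<bar>, \<bar>c\<bar>}" and ne:
    "a \<noteq> 0" "b \<noteq> 0" "c \<noteq> 0"
    "a \<noteq> b" "a \<noteq> - b" "a \<noteq> c" "a \<noteq> - c" "b \<noteq> c" "b \<noteq> - c"
    "b \<noteq> a" "- b \<noteq> a" "- a \<noteq> b" "b \<noteq> - a" "c \<noteq> a" "- c \<noteq> a" "- a \<noteq> c" "c \<noteq> - a"
    "c \<noteq> b" "- c \<noteq> b" "- b \<noteq> c" "c \<noteq> - b"
    by (rule arrangement3E)
  \<comment> \<open>The entries of \<open>v\<close> stay symbolic, so one computation serves all
    starting vertices.\<close>
  have d: "distinct (v # walk 1 ks (flip 1 v))" if "ks \<in> {A, B, C}" for ks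
    using that unfolding abc
    by (elim insertE emptyE) (simp_all add: ABC flip3 ne)
  obtain x y z where xyz: "w = [x, y, z]" "S = {\<bar>x\<bar>, \<bar>y\<bar>, \<bar>z\<bar>}" "\<bar>x\<bar> \<noteq> \<bar>y\<bar>" "\<bar>x\<bar> \<noteq> \<bar>z\<bar>" "\<bar>y\<bar> \<noteq> \<bar>z\<bar>"
    using w(1) S by (elim arrangement3E) (auto simp: abs_eq_iff)
  have "\<bar>x\<bar> \<in> {\<bar>a\<bar>, \<bar>b\<bar>, \<bar>c\<bar>}" "\<bar>y\<bar> \<in> {\<bar>a\<bar>, \<bar>b\<bar>, \<bar>c\<bar>}" "\<bar>z\<bar> \<in> {\<bar>a\<bar>, \<bar>b\<bar>, \<bar>c\<bar>}"
    using xyz(2) abc(2) by auto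
  then have "x = a \<or> x = - a \<or> x = b \<or> x = - b \<or> x = c \<or> x = - c"
    "y = a \<or> y = - a \<or> y = b \<or> y = - b \<or> y = c \<or> y = - c"
    "z = a \<or> z = - a \<or> z = b \<or> z = - b \<or> z = c \<or> z = - c"
    by (auto simp: abs_eq_iff)
  \<comment> \<open>Of the 216 combinations, those repeating an absolute value are discarded; each
    of the others is \<open>v\<close> or occurs in one of the three lists.\<close>
  then have "w \<in> set (v # ends 1 A (flip 1 v) @ ends 1 B (flip 1 v) @ ends 1 C (flip 1 v))"
    using xyz(3-5) unfolding xyz(1) abc(1)
    by (elim disjE) (simp_all add: ABC flip3 ne)
  with w obtain ks where "ks \<in> {A, B, C}" "w \<in> set (ends 1 ks (flip 1 v))" by auto
  then show ?thesis
    using v S d by (intro feasible_ends[where l = 1 and js = ks]) (auto simp: ABC)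
qed


text \<open>Recursive, so that the edges of label \<open>k\<close> in a concrete list evaluate to an
  explicit finite set.\<close>

fun label_edges :: "nat \<Rightarrow> (nat \<times> int list) list \<Rightarrow> int list set set" where
  "label_edges k [] = {}"
| "label_edges k ((i, y) # ps) =
     (if i = k then insert {y, flip i y} (label_edges k ps) else label_edges k ps)"

lemma label_edgesI: "(k, y) \<in> set ps \<Longrightarrow> {y, flip k y} \<in> label_edges k ps"
  by (induction k ps rule: label_edges.induct) auto

text \<open>As \<open>e\<close> can carry no label but \<open>k\<close>, the matchings of labels
  \<open>l\<close> and \<open>l'\<close> avoid it automatically. Only the edges of label
  \<open>k\<close> on the two walks or joining their ends need comparing with it.\<close>

lemma feasible_certificate:
  assumes e: "e \<notin> label_edges k (steps l js (flip l v) @ steps l' js' (flip l' v) @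
      [(j, last (walk l js (flip l v)))])"
    and v: "v \<in> arrangements S" and S: "S \<subseteq> {0<..}"
    and k: "\<forall>i\<in>{1..card S}. i \<noteq> k \<longrightarrow> (\<forall>x\<in>arrangements S. {x, flip i x} \<noteq> e)"
    and l: "l \<in> {1..card S}" "set js \<subseteq> {1..card S}" "distinct (v # walk l js (flip l v))"
    and l': "l' \<in> {1..card S}" "set js' \<subseteq> {1..card S}" "distinct (v # walk l' js' (flip l' v))"
    and j: "j \<in> {1..card S}"
      "last (walk l' js' (flip l' v)) = flip j (last (walk l js (flip l v)))"
    and kl: "l \<noteq> k" "l' \<noteq> k"
  shows "feasible S (\<lambda>x. of_bool (x \<noteq> v)) {e}"
proof -
  have st: "i \<in> {1..card S} \<and> y \<in> arrangements S"
    if "(i, y) \<in> set (steps m ks q)" "q \<in> arrangements S" "set ks \<subseteq> {1..card S}" for i y m ks q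
    using that by (induction m ks q rule: steps.induct) (auto simp: flip_arrangement)
  have w: "last (walk l js (flip l v)) \<in> arrangements S"
    using walk_arrangements[OF flip_arrangement[OF v]] last_in_set[OF walk_nonempty] by blast
  have ne: "{y, flip i y} \<noteq> e" if iy: "(i, y) \<in> set (steps l js (flip l v) @ steps l' js' (flip l' v) @
      [(j, last (walk l js (flip l v)))])" for i y
  proof
    assume e': "{y, flip i y} = e"
    have "i \<in> {1..card S} \<and> y \<in> arrangements S"
      using iy st[OF _ flip_arrangement[OF v] l(2)] st[OF _ flip_arrangement[OF v] l'(2)] j(1) w by auto
    with k e' have "i = k" by blast
    with iy e' have "e \<in> label_edges k (steps l js (flip l v) @ steps l' js' (flip l' v) @
      [(j, last (walk l js (flip l v)))])"
      using label_edgesI by blast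
    with e show False by contradiction
  qed
  have "\<forall>(i, y) \<in> set (steps l js (flip l v) @ steps l' js' (flip l' v) @
      [(j, last (walk l js (flip l v)))]). {y, flip i y} \<notin> {e}"
    by (rule ballI, rule case_prodI2) (use ne in blast)
  then show ?thesis
    by (intro feasible_two_walks[OF v S l l' j]) (use k l(1) l'(1) kl in blast)+
qed

lemma feasible_vertex_and_edge_fault:
  assumes v: "v \<in> arrangements S" and S: "S \<subseteq> {0<..}" "card S = 3"
  shows "feasible S (\<lambda>x. of_bool (x \<noteq> v)) {e}"
proof -
  from v S obtain a b c where abc: "v = [a, b, c]" "S = {\<bar>a\<bar>, \<bar>b\<bar>, \<bar>c\<bar>}" and ne:
    "a \<noteq> 0" "b \<noteq> 0" "c \<noteq> 0"
    "a \<noteq> b" "a \<noteq> - b" "a \<noteq> c" "a \<noteq> - c" "b \<noteq> c" "b \<noteq> - c"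
    "b \<noteq> a" "- b \<noteq> a" "- a \<noteq> b" "b \<noteq> - a" "c \<noteq> a" "- c \<noteq> a" "- a \<noteq> c" "c \<noteq> - a"
    "c \<noteq> b" "- c \<noteq> b" "- b \<noteq> c" "c \<noteq> - b"
    by (rule arrangement3E)
  have "\<exists>k\<in>{1, 2, 3}. \<forall>i\<in>{1..card S}. i \<noteq> k \<longrightarrow> (\<forall>x\<in>arrangements S. {x, flip i x} \<noteq> e)"
  proof (cases "\<exists>k\<in>{1..card S}. \<exists>y\<in>arrangements S. {y, flip k y} = e")
    case True
    then obtain k y where k: "k \<in> {1..card S}" "y \<in> arrangements S" "{y, flip k y} = e" by blast
    then have "k \<in> {1, 2, 3}" using S by auto
    moreover have "i = k" if "i \<in> {1..card S}" "x \<in> arrangements S" "{x, flip i x} = e" for i x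
    proof (rule flip_edge_label[OF that(2) k(2) S(1)])
      show "{x, flip i x} = {y, flip k y}" using that(3) k(3) by (rule trans[OF _ sym])
    qed (use that(1) k(1) in simp_all)
    ultimately show ?thesis by (intro bexI[of _ k]) blast
  next
    case False
    \<comment> \<open>If \<open>e\<close> is no edge, it carries no label and any \<open>k\<close>
      serves.\<close>
    then show ?thesis by (intro bexI[of _ 1]) blast+
  qed
  then obtain k where k: "k \<in> {1, 2, 3}"
    "\<forall>i\<in>{1..card S}. i \<noteq> k \<longrightarrow> (\<forall>x\<in>arrangements S. {x, flip i x} \<noteq> e)" ..
  let ?E = "\<lambda>l js l' js' j. label_edges k (steps l js (flip l v) @ steps l' js' (flip l' v) @
      [(j, last (walk l js (flip l v)))])"
  \<comment> \<open>An edge carries a single label \<open>k\<close>. For each \<open>k\<close> we use two pairs of walks, found by computer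
    search, whose matchings have labels other than \<open>k\<close> and which share no edge of label \<open>k\<close>;
    hence one of the two pairs avoids \<open>e\<close>.\<close>
  note cert = feasible_certificate[OF _ v S(1) k(2)]
  from k(1) consider "k = 1" | "k = 2" | "k = 3" by auto
  then show ?thesis
  proof cases
    case 1
    have "?E 2 [] 3 [1, 1, 2, 2] 1 \<inter> ?E 2 [3, 1] 3 [2, 2, 1] 1 = {}"
      unfolding 1 abc(1) by (simp add: flip3 ne doubleton_eq_iff)
    then consider "e \<notin> ?E 2 [] 3 [1, 1, 2, 2] 1" | "e \<notin> ?E 2 [3, 1] 3 [2, 2, 1] 1" by blast
    then show ?thesis
      by cases (erule cert; simp add: 1 abc(1) S(2) flip3 ne)+
  next
    case 2
    have "?E 3 [1, 2, 2, 2] 1 [2] 2 \<inter> ?E 1 [3, 2] 3 [2, 2, 2] 2 = {}"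
      unfolding 2 abc(1) by (simp add: flip3 ne doubleton_eq_iff)
    then consider "e \<notin> ?E 3 [1, 2, 2, 2] 1 [2] 2" | "e \<notin> ?E 1 [3, 2] 3 [2, 2, 2] 2" by blast
    then show ?thesis
      by cases (erule cert; simp add: 2 abc(1) S(2) flip3 ne)+
  next
    case 3
    have "?E 2 [1, 3, 3, 3] 1 [3] 3 \<inter> ?E 2 [3, 3, 3] 1 [2, 3] 3 = {}"
      unfolding 3 abc(1) by (simp add: flip3 ne doubleton_eq_iff)
    then consider "e \<notin> ?E 2 [1, 3, 3, 3] 1 [3] 3" | "e \<notin> ?E 2 [3, 3, 3] 1 [2, 3] 3" by blast
    then show ?thesis
      by cases (erule cert; simp add: 3 abc(1) S(2) flip3 ne)+
  qed
qed

lemma feasible_antimono: "feasible S d Z' \<Longrightarrow> Z \<subseteq> Z' \<Longrightarrow> feasible S d Z"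
  unfolding feasible_def weighting_def by blast

section \<open>Induction on the number of symbols\<close>

text \<open>All edges at \<open>z\<close> are given weight 0: the sum at \<open>z\<close> drops to
  0, each neighbour \<open>flip k z\<close> loses exactly \<open>h k z\<close>, and no other sum
  changes.\<close>

lemma feasible_reduce_vertex:
  assumes h: "weighting S (\<lambda>x. of_bool (x \<notin> V - {z})) Z h" and z: "z \<in> V" "z \<in> arrangements S"
    and S: "S \<subseteq> {0<..}"
  shows "feasible S (\<lambda>x. of_bool (x \<notin> V) - (\<Sum>k\<in>{1..card S}. h k z * of_bool (x = flip k z))) Z"
proof (rule feasibleI[OF weightingI[where h = "\<lambda>k x. if x = z \<or> x = flip k z then 0 else h k x"]])
  fix x k assume x: "x \<in> arrangements S" "k \<in> {1..card S}"
  show "0 \<le> (if x = z \<or> x = flip k z then 0 else h k x)"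
    using weightingD(1)[OF h x] by simp
  have "flip k x = z \<longleftrightarrow> x = flip k z" "flip k x = flip k z \<longleftrightarrow> x = z"
    using flip_eq_iff[OF z(2) x(1)] flip_eq_iff[OF flip_arrangement[OF z(2)] x(1)]
      flip_flip[of k z] length_arrangement[OF z(2)] x(2) by auto
  then show "(if flip k x = z \<or> flip k x = flip k z then 0 else h k (flip k x)) =
      (if x = z \<or> x = flip k z then 0 else h k x)"
    using weightingD(2)[OF h x] by auto
  show "{x, flip k x} \<in> Z \<Longrightarrow> (if x = z \<or> x = flip k z then 0 else h k x) = 0"
    using weightingD(3)[OF h x] by simp
next
  fix x assume x: "x \<in> arrangements S"
  show "(\<Sum>k\<in>{1..card S}. if x = z \<or> x = flip k z then 0 else h k x) =
      of_bool (x \<notin> V) - (\<Sum>k\<in>{1..card S}. h k z * of_bool (x = flip k z))"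
  proof (cases "x = z")
    case True
    have "h k z * of_bool (x = flip k z) = 0" if "k \<in> {1..card S}" for k
      using flip_neq[OF z(2) S, of k] that True by auto
    then have "(\<Sum>k\<in>{1..card S}. h k z * of_bool (x = flip k z)) = 0"
      by (intro sum.neutral) blast
    then show ?thesis using True z by simp
  next
    case False
    have "(\<Sum>k\<in>{1..card S}. if x = z \<or> x = flip k z then 0 else h k x) =
        (\<Sum>k\<in>{1..card S}. h k x - h k z * of_bool (x = flip k z))"
      using False weightingD(2)[OF h z(2)] by (intro sum.cong) auto
    also have "\<dots> = of_bool (x \<notin> V) - (\<Sum>k\<in>{1..card S}. h k z * of_bool (x = flip k z))"
      using weightingD(4)[OF h x] False by (simp add: sum_subtractf)
    finally show ?thesis .
  qed
qed

text \<open>Appending \<open>c\<close> is injective on lists and on sets of lists. So no copy has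
  more faults than the whole graph, and in case of equality every fault lies in that copy.\<close>

lemma preimage_snoc_card:
  assumes "finite V" "finite Z"
  shows "finite {x. x @ [c] \<in> V}" "finite {e. (\<lambda>x. x @ [c]) ` e \<in> Z}"
    "card {x. x @ [c] \<in> V} \<le> card V" "card {e. (\<lambda>x. x @ [c]) ` e \<in> Z} \<le> card Z"
    "card {x. x @ [c] \<in> V} = card V \<Longrightarrow> V = (\<lambda>x. x @ [c]) ` {x. x @ [c] \<in> V}"
    "card {e. (\<lambda>x. x @ [c]) ` e \<in> Z} = card Z \<Longrightarrow> Z = (\<lambda>e. (\<lambda>x. x @ [c]) ` e) ` {e. (\<lambda>x. x @ [c]) ` e \<in> Z}"
proof -
  let ?f = "\<lambda>x. x @ [c]"
  have inj: "inj ?f" "inj ((`) ?f)" by (auto simp: inj_on_def inj_image_eq_iff)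
  show "finite {x. x @ [c] \<in> V}" "finite {e. ?f ` e \<in> Z}"
    using finite_vimageI[OF assms(1) inj(1)] finite_vimageI[OF assms(2) inj(2)]
    by (simp_all add: vimage_def)
  have c: "card (?f ` {x. ?f x \<in> V}) = card {x. ?f x \<in> V}"
    "card ((`) ?f ` {e. ?f ` e \<in> Z}) = card {e. ?f ` e \<in> Z}"
    using inj by (metis card_image inj_on_subset subset_UNIV)+
  have s: "?f ` {x. ?f x \<in> V} \<subseteq> V" "(`) ?f ` {e. ?f ` e \<in> Z} \<subseteq> Z" by auto
  show "card {x. x @ [c] \<in> V} \<le> card V" "card {e. ?f ` e \<in> Z} \<le> card Z"
    using card_mono[OF assms(1) s(1)] card_mono[OF assms(2) s(2)] c by auto
  show "card {x. x @ [c] \<in> V} = card V \<Longrightarrow> V = ?f ` {x. x @ [c] \<in> V}"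
    using card_subset_eq[OF assms(1) s(1)] c by simp
  show "card {e. ?f ` e \<in> Z} = card Z \<Longrightarrow> Z = (`) ?f ` {e. ?f ` e \<in> Z}"
    using card_subset_eq[OF assms(2) s(2)] c by simp
qed

lemma feasible_few_faults_3:
  assumes S: "S \<subseteq> {0<..}" "card S = 3" and V: "V \<subseteq> arrangements S" "finite V" "finite Z"
    and c: "card V + card Z < 3"
  shows "feasible S (\<lambda>x. of_bool (x \<notin> V)) Z"
proof -
  consider "card V = 0" | "card V = 1" "card Z \<le> 1" | "card V = 2" "card Z = 0" using c by linarith
  then show ?thesis
  proof cases
    case 1
    then show ?thesis using feasible_no_vertex_faults[OF S(1) V(3)] V S(2) c by simp
  next
    case 2
    obtain v where v: "V = {v}" using 2(1) card_1_singletonE by blast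
    \<comment> \<open>Without an edge fault any \<open>e\<close> serves, since forbidding fewer
      edges preserves feasibility.\<close>
    obtain e where e: "Z \<subseteq> {e}"
    proof (cases "Z = {}")
      case False
      then have "card Z = 1" using 2(2) V(3) card_gt_0_iff[of Z] by linarith
      then show ?thesis using that card_1_singletonE by blast
    qed (use that in blast)
    have "feasible S (\<lambda>x. of_bool (x \<noteq> v)) {e}"
      using V(1) v by (intro feasible_vertex_and_edge_fault S) auto
    with e v show ?thesis by (auto intro: feasible_antimono)
  next
    case 3
    then obtain v w where "V = {v, w}" "v \<noteq> w" by (auto simp: card_2_iff)
    then show ?thesis
      using 3 V feasible_two_vertex_faults[OF _ _ _ S, of v w] by auto
  qed
qed

text \<open>All faults lie in the copy with last entry \<open>c\<close>. The neighbour \<open>y k\<close> of the restored vertex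
  \<open>z\<close> loses the weight \<open>h k z\<close> when \<open>z\<close> is deleted again, and regains it through its neighbour
  \<open>y' k\<close> outside the copy; the other copies, without \<open>y' k\<close>, are weighted by induction.\<close>

lemma feasible_concentrated_faults:
  assumes n: "4 \<le> card S" and S: "S \<subseteq> {0<..}" and c: "\<bar>c\<bar> \<in> S"
    and V0: "V0 \<subseteq> arrangements (S - {\<bar>c\<bar>})" "z \<in> V0"
    and V: "V = (\<lambda>x. x @ [c]) ` V0" and Z: "Z = (`) (\<lambda>x. x @ [c]) ` Z0" "{} \<notin> Z"
    and inner: "feasible (S - {\<bar>c\<bar>}) (\<lambda>x. of_bool (x \<notin> V0 - {z})) Z0"
    and one: "\<And>d W. \<bar>d\<bar> \<in> S \<Longrightarrow> W \<subseteq> arrangements (S - {\<bar>d\<bar>}) \<Longrightarrow> finite W \<Longrightarrow> card W \<le> 1 \<Longrightarrow>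
      feasible (S - {\<bar>d\<bar>}) (\<lambda>x. of_bool (x \<notin> W)) {}"
  shows "feasible S (\<lambda>x. of_bool (x \<notin> V)) Z"
proof -
  let ?T = "S - {\<bar>c\<bar>}"
  have fin: "finite S" "S \<noteq> {}" using n card.infinite by force+
  have T: "card ?T = card S - 1" "?T \<subseteq> {0<..}" using c fin S by auto
  have z: "z \<in> arrangements ?T" using V0 by blast
  obtain h where h: "weighting ?T (\<lambda>x. of_bool (x \<notin> V0 - {z})) Z0 h" using inner feasibleE by blast
  have Z_c: "{e. (\<lambda>x. x @ [c]) ` e \<in> Z} = Z0"
  proof -
    have "inj ((`) (\<lambda>x::int list. x @ [c]))" by (auto simp: inj_on_def inj_image_eq_iff)
    then show ?thesis unfolding Z(1) by (auto dest: injD)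
  qed
  \<comment> \<open>The other copies have no edge faults. Nonemptiness matters here: the empty set
    is its own image for every last entry.\<close>
  have Z_d: "(\<lambda>x. x @ [d]) ` e \<notin> Z" if "d \<noteq> c" for d e
  proof
    assume "(\<lambda>x. x @ [d]) ` e \<in> Z"
    moreover from this have "e \<noteq> {}" using Z(2) by auto
    ultimately obtain e' x where e': "(\<lambda>x. x @ [d]) ` e = (\<lambda>x. x @ [c]) ` e'" and "x \<in> e"
      unfolding Z(1) by blast
    then have "x @ [d] \<in> (\<lambda>x. x @ [c]) ` e'" using e' by blast
    with that show False by auto
  qed
  define y where "y k = flip k z @ [c]" for k
  have y: "y k \<in> arrangements S" "last (y k) = c" for k
    using flip_arrangement[OF z] c by (simp_all add: y_def snoc_arrangement_iff)
  define y' where "y' k = flip (card S) (y k)" for k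
  have y': "y' k \<in> arrangements S" "last (y' k) \<noteq> c" for k
    using flip_arrangement[OF y(1)] last_flip_neq[OF y(1)] n y(2) by (simp_all add: y'_def)
  \<comment> \<open>\<open>D0\<close> is supplied inside the copy after \<open>z\<close> is deleted
    again; \<open>R k\<close> is supplied outside it and leaves \<open>y' k\<close> to the edge
    joining \<open>y k\<close> and \<open>y' k\<close>.\<close>
  define D0 where "D0 x = (if last x = c then of_bool (butlast x \<notin> V0) -
      (\<Sum>k\<in>{1..card ?T}. h k z * of_bool (butlast x = flip k z)) else 0)" for x
  define R where "R k x = (of_bool (last x \<noteq> c \<and> x \<noteq> y' k) :: real)" for k x
  have D0: "feasible S D0 Z"
  proof (rule feasible_glue[OF fin])
    fix d assume d: "\<bar>d\<bar> \<in> S"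
    show "feasible (S - {\<bar>d\<bar>}) (\<lambda>x. D0 (x @ [d])) {e. (\<lambda>x. x @ [d]) ` e \<in> Z}"
    proof (cases "d = c")
      case True
      show ?thesis
        unfolding True Z_c D0_def using feasible_reduce_vertex[OF h V0(2) z T(2)] by simp
    next
      case False
      then show ?thesis by (simp add: D0_def feasible_zero)
    qed
  qed
  have E: "feasible S (\<lambda>x. of_bool (x = y k) + of_bool (x = y' k)) Z" for k
    unfolding y'_def
  proof (rule feasible_edge[OF y(1) S])
    show "{y k, flip (card S) (y k)} \<notin> Z"
    proof
      assume "{y k, flip (card S) (y k)} \<in> Z"
      then have "y' k \<in> \<Union> Z" by (auto simp: y'_def)
      then show False using y'(2)[of k] Z(1) by auto
    qed
  qed (use n in simp)
  have R: "feasible S (R k) Z" for k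
  proof (rule feasible_glue[OF fin])
    fix d assume d: "\<bar>d\<bar> \<in> S"
    show "feasible (S - {\<bar>d\<bar>}) (\<lambda>x. R k (x @ [d])) {e. (\<lambda>x. x @ [d]) ` e \<in> Z}"
    proof (cases "d = c")
      case True
      then show ?thesis by (simp add: R_def feasible_zero)
    next
      case False
      let ?W = "{x. x @ [d] = y' k}"
      have W: "?W \<subseteq> {butlast (y' k)}"
        by (intro subsetI) (metis butlast_snoc mem_Collect_eq singletonI)
      have "?W \<subseteq> arrangements (S - {\<bar>d\<bar>})"
        using y'(1)[of k] snoc_arrangement_iff by (auto simp: eq_commute)
      moreover have "finite ?W" "card ?W \<le> 1"
        using W finite_subset card_mono[OF _ W] by auto
      ultimately have "feasible (S - {\<bar>d\<bar>}) (\<lambda>x. of_bool (x \<notin> ?W)) {}" by (intro one d)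
      then show ?thesis using False Z_d[OF False] by (simp add: R_def)
    qed
  qed
  have h0: "0 \<le> h k z" if "k \<in> {1..card ?T}" for k using weightingD(1)[OF h z that] .
  \<comment> \<open>The restored \<open>z\<close> has vertex sum 1, so the \<open>h k z\<close> are
    the coefficients of a convex combination.\<close>
  have h1: "(\<Sum>k\<in>{1..card ?T}. h k z) = 1" using weightingD(4)[OF h z] by simp
  have "feasible S (\<lambda>x. D0 x +
      (\<Sum>k\<in>{1..card ?T}. h k z * ((of_bool (x = y k) + of_bool (x = y' k)) + R k x))) Z"
    by (rule feasible_add[OF D0 feasible_sum[OF _ feasible_scale[OF feasible_add[OF E R] h0]]]) simp_all
  then show ?thesis
  proof (rule feasible_cong)
    fix x assume x: "x \<in> arrangements S"
    then have "x \<noteq> []" using length_arrangement[OF x] n by auto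
    then obtain u d where u: "x = u @ [d]" by (metis rev_exhaust)
    show "D0 x + (\<Sum>k\<in>{1..card ?T}. h k z * ((of_bool (x = y k) + of_bool (x = y' k)) + R k x)) =
        of_bool (x \<notin> V)"
    \<comment> \<open>Inside the copy the terms for \<open>y k\<close> cancel the losses in
      \<open>D0\<close>; outside, the summands reduce to \<open>h k z\<close>, with total 1.\<close>
    proof (cases "d = c")
      case True
      have "x \<noteq> y' k" for k using y'(2)[of k] u True by (metis last_snoc)
      then have "D0 x + (\<Sum>k\<in>{1..card ?T}. h k z * ((of_bool (x = y k) + of_bool (x = y' k)) + R k x)) =
          of_bool (u \<notin> V0)"
        unfolding u True D0_def R_def y_def by simp
      also have "u \<notin> V0 \<longleftrightarrow> x \<notin> V" unfolding V u True by auto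
      finally show ?thesis .
    next
      case False
      then have "x \<noteq> y k" for k using y(2)[of k] u by (metis last_snoc)
      then have "(of_bool (x = y k) + of_bool (x = y' k)) + R k x = 1" for k
        using False u by (simp add: R_def)
      moreover have "x \<notin> V" "D0 x = 0" using False u by (auto simp: V D0_def)
      ultimately show ?thesis using h1 by simp
    qed
  qed
qed

lemma feasible_few_faults:
  assumes "3 \<le> card S" "S \<subseteq> {0<..}" "V \<subseteq> arrangements S" "finite V" "finite Z" "{} \<notin> Z"
    and "card V + card Z < card S"
  shows "feasible S (\<lambda>x. of_bool (x \<notin> V)) Z"
  using assms
proof (induction "card S" arbitrary: S V Z rule: less_induct)
  case less
  note S = less.prems(1,2) and V = less.prems(3-7)
  show ?case
  proof (cases "card S = 3")
    case True
    then show ?thesis using feasible_few_faults_3 S V by simp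
  next
    case False
    with S have n: "4 \<le> card S" by simp
    have fin: "finite S" "S \<noteq> {}" using n card.infinite by force+
    have card: "card (S - {\<bar>c\<bar>}) = card S - 1" if "\<bar>c\<bar> \<in> S" for c using that fin by simp
    have IH: "feasible (S - {\<bar>c\<bar>}) (\<lambda>x. of_bool (x \<notin> V)) Z"
      if "\<bar>c\<bar> \<in> S" "V \<subseteq> arrangements (S - {\<bar>c\<bar>})" "finite V" "finite Z" "{} \<notin> Z"
        "card V + card Z < card S - 1" for c V Z
      by (rule less.hyps) (use that card[OF that(1)] n S in auto)
    define Vc where "Vc c = {x. x @ [c] \<in> V}" for c
    define Zc where "Zc c = {e. (\<lambda>x. x @ [c]) ` e \<in> Z}" for c
    note pre = preimage_snoc_card[OF V(2,3), folded Vc_def Zc_def]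
    have Vc: "Vc c \<subseteq> arrangements (S - {\<bar>c\<bar>})" "{} \<notin> Zc c" for c
      using V(1,4) snoc_arrangement_iff by (auto simp: Vc_def Zc_def)
    \<comment> \<open>Without vertex faults there is nothing to restore, so that case is split off.
      At most \<open>card S - 1\<close> faults exist, so a copy with that many contains all of
      them.\<close>
    consider "V = {}" | "V \<noteq> {}" "\<exists>c. \<bar>c\<bar> \<in> S \<and> card S - 1 \<le> card (Vc c) + card (Zc c)"
      | "\<And>c. \<bar>c\<bar> \<in> S \<Longrightarrow> card (Vc c) + card (Zc c) < card S - 1" by (meson not_le)
    then show ?thesis
    proof cases
      case 1
      then show ?thesis using feasible_no_vertex_faults[OF S(2) V(3)] V by simp
    next
      case 3
      show ?thesis
      proof (rule feasible_glue[OF fin])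
        fix c assume c: "\<bar>c\<bar> \<in> S"
        have "feasible (S - {\<bar>c\<bar>}) (\<lambda>x. of_bool (x \<notin> Vc c)) (Zc c)"
          by (rule IH) (use c Vc pre 3 in auto)
        then show "feasible (S - {\<bar>c\<bar>}) (\<lambda>x. of_bool (x @ [c] \<notin> V)) {e. (\<lambda>x. x @ [c]) ` e \<in> Z}"
          by (simp add: Vc_def Zc_def)
      qed
    next
      case 2
      then obtain c where c: "\<bar>c\<bar> \<in> S" "card S - 1 \<le> card (Vc c) + card (Zc c)" by blast
      have eq: "card (Vc c) = card V" "card (Zc c) = card Z"
        "card V + card Z = card S - 1"
        using pre(3,4)[of c] c(2) V(5) by linarith+
      note img = pre(5)[OF eq(1)] pre(6)[OF eq(2)]
      obtain z where z: "z \<in> Vc c" using img(1) 2(1) by blast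
      show ?thesis
      proof (rule feasible_concentrated_faults[OF n S(2) c(1) Vc(1) z img V(4)])
        \<comment> \<open>Restoring \<open>z\<close> leaves \<open>card S - 2\<close> faults, within
          the bound for \<open>card S - 1\<close> symbols.\<close>
        have "card (Vc c - {z}) < card (Vc c)" using z pre(1) by (intro psubset_card_mono) auto
        then show "feasible (S - {\<bar>c\<bar>}) (\<lambda>x. of_bool (x \<notin> Vc c - {z})) (Zc c)"
          using Vc pre eq by (intro IH c) auto
      next
        fix d and W :: "int list set"
        assume "\<bar>d\<bar> \<in> S" "W \<subseteq> arrangements (S - {\<bar>d\<bar>})" "finite W" "card W \<le> 1"
        \<comment> \<open>A single vertex fault is within the bound, as \<open>card S - 1\<close> is
          at least 3.\<close>
        then show "feasible (S - {\<bar>d\<bar>}) (\<lambda>x. of_bool (x \<notin> W)) {}"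
          using n by (intro IH) auto
      qed
    qed
  qed
qed

section \<open>The burnt pancake graph\<close>

lemma signed_permutations_eq: "signed_permutations n = arrangements {1..int n}"
proof -
  have "length a = n" if "a \<in> arrangements {1..int n}" for a
    using length_arrangement[OF that] by simp
  then show ?thesis unfolding signed_permutations_def arrangements_def by blast
qed

lemma burnt_pancake_adj_iff:
  assumes "length a = n" "length b = n"
  shows "burnt_pancake_adj n a b \<longleftrightarrow> (\<exists>k\<in>{1..n}. b = flip k a)"
proof -
  have "((\<forall>i. 1 \<le> i \<and> i \<le> k \<longrightarrow> b ! (i - 1) = - (a ! (k + 1 - i - 1))) \<and>
      (\<forall>i. k + 1 \<le> i \<and> i \<le> n \<longrightarrow> b ! (i - 1) = a ! (i - 1))) \<longleftrightarrow> b = flip k a"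
    if k: "1 \<le> k" "k \<le> n" for k
  proof
    assume *: "(\<forall>i. 1 \<le> i \<and> i \<le> k \<longrightarrow> b ! (i - 1) = - (a ! (k + 1 - i - 1))) \<and>
      (\<forall>i. k + 1 \<le> i \<and> i \<le> n \<longrightarrow> b ! (i - 1) = a ! (i - 1))"
    show "b = flip k a"
    proof (rule nth_equalityI)
      fix i assume i: "i < length b"
      \<comment> \<open>List position \<open>i\<close> holds entry \<open>Suc i\<close> of the
        sequence.\<close>
      then show "b ! i = flip k a ! i"
        using * [THEN conjunct1, rule_format, of "Suc i"] * [THEN conjunct2, rule_format, of "Suc i"]
          flip_nth[of k a i] k assms by (auto simp: diff_diff_left)
    qed (simp add: assms)
  next
    assume b: "b = flip k a"
    show "(\<forall>i. 1 \<le> i \<and> i \<le> k \<longrightarrow> b ! (i - 1) = - (a ! (k + 1 - i - 1))) \<and>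
      (\<forall>i. k + 1 \<le> i \<and> i \<le> n \<longrightarrow> b ! (i - 1) = a ! (i - 1))"
    proof (intro conjI allI impI)
      fix i assume "1 \<le> i \<and> i \<le> k"
      then obtain m where "i = Suc m" "m < k" by (metis Suc_le_eq less_eq_Suc_le not0_implies_Suc not_one_le_zero)
      then show "b ! (i - 1) = - (a ! (k + 1 - i - 1))"
        unfolding b using flip_nth[of k a m] k assms by simp
    next
      fix i assume "k + 1 \<le> i \<and> i \<le> n"
      then obtain m where "i = Suc m" "k \<le> m" "m < n" by (metis Suc_eq_plus1 Suc_le_D Suc_le_eq Suc_le_mono)
      then show "b ! (i - 1) = a ! (i - 1)"
        unfolding b using flip_nth[of k a m] k assms by simp
    qed
  qed
  then show ?thesis unfolding burnt_pancake_adj_def Bex_def atLeastAtMost_iff by blast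
qed

lemma verts_burnt_pancake_graph: "verts (burnt_pancake_graph n) = arrangements {1..int n}"
  by (simp add: verts_def burnt_pancake_graph_def signed_permutations_eq)

lemma edges_burnt_pancake_graph:
  "edges (burnt_pancake_graph n) =
    {{x, flip k x} | x k. x \<in> arrangements {1..int n} \<and> k \<in> {1..n}}" (is "_ = ?E")
proof -
  have adj: "burnt_pancake_adj n a b \<longleftrightarrow> (\<exists>k\<in>{1..n}. b = flip k a)"
    if "a \<in> arrangements {1..int n}" "b \<in> arrangements {1..int n}" for a b
    using that[THEN length_arrangement] by (intro burnt_pancake_adj_iff) simp_all
  have E: "edges (burnt_pancake_graph n) = {{a, b} | a b. a \<in> arrangements {1..int n} \<and>
      b \<in> arrangements {1..int n} \<and> burnt_pancake_adj n a b}"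
    by (simp add: edges_def burnt_pancake_graph_def signed_permutations_eq)
  show ?thesis
  proof (intro equalityI subsetI)
    fix e assume "e \<in> edges (burnt_pancake_graph n)"
    then show "e \<in> ?E" unfolding E using adj by blast
  next
    fix e assume "e \<in> ?E"
    then obtain x k where x: "e = {x, flip k x}" "x \<in> arrangements {1..int n}" "k \<in> {1..n}" by blast
    then have "burnt_pancake_adj n x (flip k x)" using adj[OF x(2) flip_arrangement[OF x(2)]] by blast
    then show "e \<in> edges (burnt_pancake_graph n)"
      unfolding E x(1) using x(2) flip_arrangement by blast
  qed
qed

text \<open>Since \<open>flip k\<close> is an involution on arrangements, every edge through
  \<open>v\<close> can be written with \<open>v\<close> first.\<close>

lemma burnt_pancake_edges_at:
  assumes v: "v \<in> arrangements {1..int n}"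
  shows "{e \<in> edges (burnt_pancake_graph n). v \<in> e} = (\<lambda>k. {v, flip k v}) ` {1..n}"
proof (intro equalityI subsetI)
  fix e assume "e \<in> {e \<in> edges (burnt_pancake_graph n). v \<in> e}"
  then obtain x k where x: "e = {x, flip k x}" "x \<in> arrangements {1..int n}" "k \<in> {1..n}" "v \<in> e"
    unfolding edges_burnt_pancake_graph by blast
  have "flip k (flip k x) = x" using x flip_flip[of k x] length_arrangement[OF x(2)] by simp
  then have "e = {v, flip k v}" using x(1,4) by auto
  with x(3) show "e \<in> (\<lambda>k. {v, flip k v}) ` {1..n}" by blast
next
  fix e assume "e \<in> (\<lambda>k. {v, flip k v}) ` {1..n}"
  then show "e \<in> {e \<in> edges (burnt_pancake_graph n). v \<in> e}"
    unfolding edges_burnt_pancake_graph using v by blast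
qed

lemma fractional_perfect_matching_few_faults:
  assumes n: "3 \<le> n" and F: "F \<subseteq> verts (burnt_pancake_graph n) <+> edges (burnt_pancake_graph n)"
    and fin: "finite F" and card: "card F < n"
  shows "\<exists>g. fractional_perfect_matching (delete_verts_edges (burnt_pancake_graph n) F) g"
proof -
  let ?S = "{1..int n}" and ?G = "burnt_pancake_graph n"
  define V where "V = {v. Inl v \<in> F}"
  define Z where "Z = {e. Inr e \<in> F}"
  have F_eq: "F = V <+> Z"
  proof (rule set_eqI)
    show "x \<in> F \<longleftrightarrow> x \<in> V <+> Z" for x by (cases x) (auto simp: V_def Z_def)
  qed
  have fin': "finite V" "finite Z" using fin unfolding F_eq by simp_all
  have "card V + card Z < n" using card fin' unfolding F_eq by (simp add: card_Plus)
  moreover have "V \<subseteq> arrangements ?S" "Z \<subseteq> edges ?G"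
    using F unfolding verts_burnt_pancake_graph V_def Z_def by auto
  moreover from this have "{} \<notin> Z" unfolding edges_burnt_pancake_graph by blast
  ultimately have "feasible ?S (\<lambda>x. of_bool (x \<notin> V)) Z"
    using n fin' by (intro feasible_few_faults) auto
  then obtain h where h: "weighting ?S (\<lambda>x. of_bool (x \<notin> V)) Z h" by (rule feasibleE)
  have S: "?S \<subseteq> {0<..}" by auto
  \<comment> \<open>Well defined on edges: an edge has one label, and \<open>h\<close> agrees at its
    two endpoints.\<close>
  define g where "g e = (THE r. \<exists>x\<in>arrangements ?S. \<exists>k\<in>{1..n}. e = {x, flip k x} \<and> r = h k x)" for e
  have g: "g {x, flip k x} = h k x" if x: "x \<in> arrangements ?S" and k: "k \<in> {1..n}" for x k
    unfolding g_def
  proof (rule the_equality)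
    fix r assume "\<exists>y\<in>arrangements ?S. \<exists>l\<in>{1..n}. {x, flip k x} = {y, flip l y} \<and> r = h l y"
    then obtain y l where y: "y \<in> arrangements ?S" "l \<in> {1..n}" "{x, flip k x} = {y, flip l y}" "r = h l y"
      by blast
    have "k = l" using flip_edge_label[OF x y(1) S _ _ y(3)] k y(2) by simp
    moreover have "y = x \<or> y = flip k x" using y(3) by blast
    ultimately show "r = h k x" using y(4) weightingD(2)[OF h x] k by auto
  qed (use x k in blast)
  \<comment> \<open>Bounds the weights by 1 and, at a deleted vertex, by 0; so edges meeting
    \<open>V\<close> contribute nothing to the sums below.\<close>
  have h_le: "h k x \<le> of_bool (x \<notin> V)" if "x \<in> arrangements ?S" "k \<in> {1..n}" for x k
    using member_le_sum[of k "{1..n}" "\<lambda>k. h k x"] weightingD(1,4)[OF h that(1)] that(2) by simp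
  have "fractional_perfect_matching (delete_verts_edges ?G F) g"
    unfolding fractional_perfect_matching_def
  proof (intro conjI ballI)
    fix e assume "e \<in> edges (delete_verts_edges ?G F)"
    then have "e \<in> edges ?G" by (simp add: delete_verts_edges_def edges_def)
    then obtain x k where "x \<in> arrangements ?S" "k \<in> {1..n}" "e = {x, flip k x}"
      unfolding edges_burnt_pancake_graph by blast
    then show "0 \<le> g e" "g e \<le> 1"
      using g h_le[of x k] weightingD(1)[OF h, of x k] by (auto simp: of_bool_def split: if_splits)
  next
    fix v assume "v \<in> verts (delete_verts_edges ?G F)"
    then have v: "v \<in> arrangements ?S" "v \<notin> V"
      by (simp_all add: delete_verts_edges_def verts_def V_def flip: verts_burnt_pancake_graph)
    \<comment> \<open>The labels of the surviving edges at \<open>v\<close>; all other labels have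
      weight 0 there.\<close>
    define K where "K = {k \<in> {1..n}. {v, flip k v} \<notin> Z \<and> flip k v \<notin> V}"
    have "{e \<in> edges (delete_verts_edges ?G F). v \<in> e} =
        {e \<in> {e \<in> edges ?G. v \<in> e}. e \<notin> Z \<and> (\<forall>u\<in>e. u \<notin> V)}"
      by (auto simp: delete_verts_edges_def edges_def V_def Z_def)
    also have "\<dots> = (\<lambda>k. {v, flip k v}) ` K"
      unfolding burnt_pancake_edges_at[OF v(1)] K_def using v(2) by auto
    finally have *: "{e \<in> edges (delete_verts_edges ?G F). v \<in> e} = (\<lambda>k. {v, flip k v}) ` K" .
    have "inj_on (\<lambda>k. {v, flip k v}) K"
      by (intro inj_onI flip_edge_label[OF v(1) v(1) S]) (auto simp: K_def)
    then have "(\<Sum>e\<in>{e \<in> edges (delete_verts_edges ?G F). v \<in> e}. g e) = (\<Sum>k\<in>K. g {v, flip k v})"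
      unfolding * by (simp add: sum.reindex)
    also have "\<dots> = (\<Sum>k\<in>K. h k v)"
      using g[OF v(1)] by (intro sum.cong) (auto simp: K_def)
    also have "\<dots> = (\<Sum>k\<in>{1..n}. h k v)"
    proof (intro sum.mono_neutral_left ballI)
      fix k assume k: "k \<in> {1..n} - K"
      then consider "{v, flip k v} \<in> Z" | "flip k v \<in> V" by (auto simp: K_def)
      then show "h k v = 0"
      proof cases
        case 1
        then show ?thesis using weightingD(3)[OF h v(1)] k by simp
      next
        case 2
        then show ?thesis
          using h_le[OF flip_arrangement[OF v(1)], of k k] weightingD(1,2)[OF h v(1), of k] k by simp
      qed
    qed (auto simp: K_def)
    also have "\<dots> = 1" using weightingD(4)[OF h v(1)] v(2) by simp
    finally show "(\<Sum>e\<in>{e \<in> edges (delete_verts_edges ?G F). v \<in> e}. g e) = 1" .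
  qed
  then show ?thesis by blast
qed

text \<open>Fault sets of edges alone embed via \<open>Inr\<close> among the mixed ones, with the
  same cardinality and the same remaining graph.\<close>

lemma fsmp_le_fmp: "fsmp G \<le> fmp G"
  unfolding fmp_def
proof (rule INF_greatest)
  fix F assume F: "F \<in> {F. F \<subseteq> edges G \<and> finite F \<and>
      \<not> (\<exists>g. fractional_perfect_matching (delete_edges G F) g)}"
  have "delete_verts_edges G (Inr ` F) = delete_edges G F"
    by (auto simp: delete_verts_edges_def delete_edges_def verts_def)
  with F show "fsmp G \<le> enat (card F)"
    unfolding fsmp_def by (intro INF_lower2[of "Inr ` F"]) (auto simp: card_image)
qed

text \<open>Deleting the at most \<open>n\<close> edges at the identity arrangement leaves an empty
  sum there, which is not 1.\<close>

lemma fmp_burnt_pancake_graph_le: "fmp (burnt_pancake_graph n) \<le> enat n"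
proof -
  let ?G = "burnt_pancake_graph n"
  define v where "v = map int [1..<Suc n]"
  have "map abs v = v" by (simp add: v_def del: upt_Suc)
  moreover have "distinct v" by (simp add: v_def distinct_map del: upt_Suc)
  moreover have "set v = {1..int n}"
    using image_int_atLeastAtMost[of 1 n] by (simp add: v_def atLeastLessThanSuc_atLeastAtMost del: upt_Suc)
  ultimately have v: "v \<in> arrangements {1..int n}" by (simp add: arrangements_def)
  define F where "F = (\<lambda>k. {v, flip k v}) ` {1..n}"
  have at: "{e \<in> edges ?G. v \<in> e} = F" unfolding F_def by (rule burnt_pancake_edges_at[OF v])
  have "\<not> fractional_perfect_matching (delete_edges ?G F) g" for g
  proof
    assume "fractional_perfect_matching (delete_edges ?G F) g"
    then have "(\<Sum>e\<in>{e \<in> edges (delete_edges ?G F). v \<in> e}. g e) = 1"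
      using v by (simp add: fractional_perfect_matching_def delete_edges_def verts_def
          flip: verts_burnt_pancake_graph)
    moreover have "{e \<in> edges (delete_edges ?G F). v \<in> e} = {}"
      using at by (auto simp: delete_edges_def edges_def)
    ultimately show False by simp
  qed
  moreover have "F \<subseteq> edges ?G" "finite F" using at by (auto simp: F_def)
  moreover have "card F \<le> n" using card_image_le[of "{1..n}"] by (auto simp: F_def)
  ultimately show ?thesis unfolding fmp_def by (intro INF_lower2[of F]) auto
qed

theorem theorem4p41:
  fixes n :: nat
  assumes "n \<ge> 3"
  shows "fsmp (burnt_pancake_graph n) = fmp (burnt_pancake_graph n) \<and>
         fmp (burnt_pancake_graph n) = enat n"
proof -
  have "enat n \<le> fsmp (burnt_pancake_graph n)"
    unfolding fsmp_def
    by (rule INF_greatest) (use fractional_perfect_matching_few_faults[OF assms] in \<open>auto simp: not_less[symmetric]\<close>)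
  \<comment> \<open>The chain \<open>n \<le> fsmp \<le> fmp \<le> n\<close> closes.\<close>
  with fsmp_le_fmp[of "burnt_pancake_graph n"] fmp_burnt_pancake_graph_le[of n]
  show ?thesis by (meson antisym order_trans)
qed

end
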